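(* Let $X$ be a nonzero real Banach space, and let $x\mapsto f_x$ be a support map on $X$. Then the following are equivalent. (i) $X$ has non-trivial maximal roundness, i.e. $\mathrm{mr}(X)>1$. (ii) $\rho_X$ is of power type $p$, for some $p>1$. (iii) $X$ is $s$-uniformly smooth, for some $s>1$. (iv) There exists some $r>1$ such that $\|x+ty\|=1+f_x(y)t+O(|t|^r)$ as $t\to0$, uniformly over all $x,y\in S_X$. (v) $X^*$ has non-trivial minimal coroundness, i.e. $\mathrm{mc}(X^* )<\infty$. (vi) $\delta_{X^*}$ is of power type $q$, for some $q\geq 2$. (vii) $X^*$ is $w$-uniformly convex, for some $w\geq 2$.
   Context: $S_X$ is the unit sphere of $X$. A metric space $(X,d)$ has roundness $p\geq 1$ if for all $a_1,a_2,b_1,b_2\in X$, $d(a_1,a_2)^p+d(b_1,b_2)^p\leq\sum_{1\leq i,j\leq 2}d(a_i,b_j)^p$; for a Banach space this is equivalent (Enflo) to $\|x+y\|^p+\|x-y\|^p\leq 2(\|x\|^p+\|y\|^p)$ for all $x,y\in X$. Put $\mathrm{mr}(X)=\sup\{p\geq 1: X\text{ has roundness }p\}$. For $p\ge1$ let $\nu_X(p)=\sup\left\{\frac{\|x+y\|^p+\|x-y\|^p}{\|x\|^p+\|y\|^p}: x,y\in X\text{ not both zero}\right\}$ and $\mathrm{mc}(X)=\inf\{p:\nu_X(p)=2^{p-1}\}$, with $\mathrm{mc}(X)=\infty$ if the set is empty. (For $2\le p<\infty$, $\nu_X(p)=2^{p-1}$ is equivalent to $X$ having coroundness $p$: $\|x+y\|^p+\|x-y\|^p\leq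 2^{p-1}(\|x\|^p+\|y\|^p)$ for all $x,y$.) Modulus of uniform smoothness: $\rho_X(t)=\sup\{\frac12(\|x+y\|+\|x-y\|)-1:\|x\|=1,\|y\|=t\}$ for $t\ge0$; it is of power type $p\ge1$ if there is $C>0$ with $\rho_X(t)\leq Ct^p$ for all $t\geq0$. Modulus of uniform convexity: $\delta_X(\epsilon)=\inf\{1-\frac{\|x+y\|}{2}:\|x\|=\|y\|=1,\|x-y\|\geq\epsilon\}$ for $\epsilon\in[0,2]$; it is of power type $q\geq2$ if there is $C>0$ with $\delta_X(\epsilon)\geq C\epsilon^q$ for all $\epsilon\in[0,2)$. For $1\le p\le2$, $X$ is $p$-uniformly smooth if there is $K>0$ with $\|x+y\|^p+\|x-y\|^p\leq 2(\|x\|^p+\|Ky\|^p)$ for all $x,y\in X$. For $2\le q<\infty$, $X$ is $q$-uniformly convex if there is $K>0$ with $\|x+y\|^q+\|x-y\|^q\geq 2(\|x\|^q+\|Ky\|^q)$ for all $x,y\in X$. A support map on $X$ is a map $X\setminus\{0\}\to X^*\setminus\{0\}$, $x\mapsto f_x$, such that (a) for each $x\in S_X$, $\|f_x\|=1$ and $f_x(x)=\|x\|=1$; (b) $f_{\lambda x}=\lambda f_x$ for all $x\neq0$ and $\lambda>0$. The uniform $O$ in (iv) means: there exist $C>0$ and $t_0>0$ such that $\big|\|x+ty\|-1-f_x(y)t\big|\leq C|t|^r$ for all $|t|<t_0$ and all $x,y\in S_X$. *)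

theory Defs
  imports "HOL-Analysis.Analysis"
begin

text \<open>
  A space \<open>X\<close> is a type, passed as an argument of type \<open>'a itself\<close>; the dual \<open>X\<^sup>*\<close> of a real
  normed space is the type \<open>'a \<Rightarrow>\<^sub>L real\<close> with the operator norm. Powers with real exponents are
  taken with \<open>powr\<close>; since all exponents are at least 1, the convention \<open>0 powr p = 0\<close> is the
  expected one. The real-valued \<open>Sup\<close> and \<open>Inf\<close> below range over nonempty bounded sets as soon as
  the space is nonzero and the parameters satisfy \<open>p \<ge> 1\<close>, \<open>t \<ge> 0\<close>, \<open>0 \<le> \<epsilon> \<le> 2\<close>.
\<close>

definition has_roundness :: "'a::metric_space itself \<Rightarrow> real \<Rightarrow> bool" where
  "has_roundness X p \<longleftrightarrow> 1 \<le> p \<and>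
     (\<forall>a1 a2 b1 b2 :: 'a.
        dist a1 a2 powr p + dist b1 b2 powr p
        \<le> dist a1 b1 powr p + dist a1 b2 powr p + dist a2 b1 powr p + dist a2 b2 powr p)"

definition max_roundness :: "'a::metric_space itself \<Rightarrow> ereal" where
  "max_roundness X = Sup {ereal p | p. 1 \<le> p \<and> has_roundness X p}"

text \<open>The set in the following supremum is bounded above by \<open>2 powr p\<close>.\<close>

definition nu_const :: "'a::real_normed_vector itself \<Rightarrow> real \<Rightarrow> real" where
  "nu_const X p =
     Sup {(norm (x + y) powr p + norm (x - y) powr p) / (norm x powr p + norm y powr p)
          | x y :: 'a. x \<noteq> 0 \<or> y \<noteq> 0}"

text \<open>In the extended reals the infimum of the empty set is \<open>\<infinity>\<close>.\<close>

definition min_coroundness :: "'a::real_normed_vector itself \<Rightarrow> ereal" where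
  "min_coroundness X = Inf {ereal p | p. 1 \<le> p \<and> nu_const X p = 2 powr (p - 1)}"

definition smoothness_modulus :: "'a::real_normed_vector itself \<Rightarrow> real \<Rightarrow> real" where
  "smoothness_modulus X t =
     Sup {(norm (x + y) + norm (x - y)) / 2 - 1 | x y :: 'a. norm x = 1 \<and> norm y = t}"

definition smoothness_power_type :: "'a::real_normed_vector itself \<Rightarrow> real \<Rightarrow> bool" where
  "smoothness_power_type X p \<longleftrightarrow> 1 \<le> p \<and>
     (\<exists>C>0. \<forall>t\<ge>0. smoothness_modulus X t \<le> C * t powr p)"

definition convexity_modulus :: "'a::real_normed_vector itself \<Rightarrow> real \<Rightarrow> real" where
  "convexity_modulus X \<epsilon> =
     Inf {1 - norm (x + y) / 2 | x y :: 'a. norm x = 1 \<and> norm y = 1 \<and> norm (x - y) \<ge> \<epsilon>}"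

definition convexity_power_type :: "'a::real_normed_vector itself \<Rightarrow> real \<Rightarrow> bool" where
  "convexity_power_type X q \<longleftrightarrow> 2 \<le> q \<and>
     (\<exists>C>0. \<forall>\<epsilon>\<in>{0..<2}. convexity_modulus X \<epsilon> \<ge> C * \<epsilon> powr q)"

definition uniformly_smooth :: "'a::real_normed_vector itself \<Rightarrow> real \<Rightarrow> bool" where
  "uniformly_smooth X p \<longleftrightarrow> 1 \<le> p \<and> p \<le> 2 \<and>
     (\<exists>K>0. \<forall>x y :: 'a.
        norm (x + y) powr p + norm (x - y) powr p
        \<le> 2 * (norm x powr p + norm (K *\<^sub>R y) powr p))"

definition uniformly_convex :: "'a::real_normed_vector itself \<Rightarrow> real \<Rightarrow> bool" where
  "uniformly_convex X q \<longleftrightarrow> 2 \<le> q \<and>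
     (\<exists>K>0. \<forall>x y :: 'a.
        norm (x + y) powr q + norm (x - y) powr q
        \<ge> 2 * (norm x powr q + norm (K *\<^sub>R y) powr q))"

text \<open>A support map is only defined on nonzero vectors; the value \<open>f 0\<close> is unconstrained.\<close>

definition support_map :: "('a::real_normed_vector \<Rightarrow> ('a \<Rightarrow>\<^sub>L real)) \<Rightarrow> bool" where
  "support_map f \<longleftrightarrow>
     (\<forall>x. x \<noteq> 0 \<longrightarrow> f x \<noteq> 0) \<and>
     (\<forall>x. norm x = 1 \<longrightarrow> norm (f x) = 1 \<and> blinfun_apply (f x) x = 1) \<and>
     (\<forall>x c. x \<noteq> 0 \<and> 0 < c \<longrightarrow> f (c *\<^sub>R x) = c *\<^sub>R f x)"

text \<open>\<open>\<parallel>x + ty\<parallel> = 1 + f\<^sub>x(y) t + O(|t|\<^sup>r)\<close> as \<open>t \<rightarrow> 0\<close>, uniformly over unit vectors \<open>x\<close>, \<open>y\<close>.\<close>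

definition uniform_norm_expansion ::
    "('a::real_normed_vector \<Rightarrow> ('a \<Rightarrow>\<^sub>L real)) \<Rightarrow> real \<Rightarrow> bool" where
  "uniform_norm_expansion f r \<longleftrightarrow>
     (\<exists>C>0. \<exists>t0>0. \<forall>t x y. \<bar>t\<bar> < t0 \<and> norm x = 1 \<and> norm y = 1 \<longrightarrow>
        \<bar>norm (x + t *\<^sub>R y) - 1 - blinfun_apply (f x) y * t\<bar> \<le> C * \<bar>t\<bar> powr r)"

end

theory Submission
  imports Defs
begin

text \<open>
  For a normed space, roundness \<open>p\<close> is the inequality
  \<open>norm (x + y) powr p + norm (x - y) powr p \<le> 2 * (norm x powr p + norm y powr p)\<close>
  (lemma \<open>has_roundness_iff_roundness_ineq\<close>). It is \<open>p\<close>-uniform smoothness with \<open>K = 1\<close>, and its formal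
  dual, for the conjugate exponent \<open>q = p / (p - 1)\<close>, is \<open>q\<close>-uniform convexity of the dual space with
  \<open>K = 1\<close>, which is coroundness \<open>q\<close> in other coordinates. Most implications thus amount to a duality or to
  forgetting a constant, and they close into two cycles starting from roundness: through uniform smoothness
  to smoothness of power type; and through coroundness and uniform convexity of the dual to convexity of
  power type of the dual, then by Lindenstrauss' duality of the moduli to smoothness of power type. The
  expansion of the norm is a reformulation of smoothness of power type, because the first-order remainders
  at \<open>t\<close> and \<open>- t\<close> are nonnegative and add up to a second difference of the norm.

  What remains is the return from smoothness of power type \<open>r > 1\<close>, with an arbitrary constant, to roundness
  \<open>p > 1\<close>, where the constant is exact (lemma \<open>smoothness_power_type_imp_roundness_ineq\<close>). This costs part
  of the exponent. For \<open>norm y\<close> small compared to \<open>norm x\<close> any \<open>p\<close> strictly between \<open>1\<close> and \<open>min r 2\<close>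
  absorbs the constant. For the other pairs smoothness gives a uniform gain over the triangle
  inequality, so the case \<open>p = 1\<close> is strict with room to spare, and the inequality persists for \<open>p\<close> slightly
  above \<open>1\<close>.
\<close>

section \<open>Elementary inequalities for real powers\<close>

text \<open>Concavity of \<open>u powr s\<close>, in the form that it lies below its tangent at \<open>1\<close>.\<close>

lemma powr_le_tangent_at_1:
  fixes u s :: real
  assumes "0 \<le> u" "0 \<le> s" "s \<le> 1"
  shows "u powr s \<le> 1 + s * (u - 1)"
proof (cases "u = 0")
  case True
  then show ?thesis using assms by simp
next
  case False
  then show ?thesis
    using Youngs_inequality_0[of s "1 - s" u 1] assms by (simp add: algebra_simps)
qed

lemma powr_ge_tangent_at_1:
  fixes u p :: real
  assumes "0 \<le> u" "1 \<le> p"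
  shows "1 + p * (u - 1) \<le> u powr p"
proof -
  have "(u powr p) powr (1 / p) \<le> 1 + (1 / p) * (u powr p - 1)"
    using assms by (intro powr_le_tangent_at_1) auto
  moreover have "(u powr p) powr (1 / p) = u"
    using assms by (simp add: powr_powr)
  ultimately have "p * u \<le> p * (1 + (1 / p) * (u powr p - 1))"
    using assms by (intro mult_left_mono) auto
  also have "\<dots> = p + u powr p - 1"
    using assms by (simp add: algebra_simps)
  finally show ?thesis by (simp add: algebra_simps)
qed

lemma powr_midpoint_le:
  fixes a b p :: real
  assumes "0 \<le> a" "0 \<le> b" "1 \<le> p"
  shows "((a + b) / 2) powr p \<le> (a powr p + b powr p) / 2"
proof (cases "a + b = 0")
  case True
  then show ?thesis by simp
next
  case False
  define m where "m = (a + b) / 2"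
  have m: "m > 0" using False assms unfolding m_def by auto
  have "2 = (1 + p * (a / m - 1)) + (1 + p * (b / m - 1))"
  proof -
    have "a + b = 2 * m" by (simp add: m_def)
    then have "a / m + b / m = 2"
      using m unfolding add_divide_distrib[symmetric] by simp
    moreover have "(1 + p * (a / m - 1)) + (1 + p * (b / m - 1)) = 2 + p * (a / m + b / m - 2)"
      by (simp add: algebra_simps)
    ultimately show ?thesis by simp
  qed
  also have "\<dots> \<le> (a / m) powr p + (b / m) powr p"
    using assms m by (intro add_mono powr_ge_tangent_at_1) auto
  also have "\<dots> = (a powr p + b powr p) / m powr p"
    by (simp add: powr_divide add_divide_distrib)
  finally show ?thesis
    using m by (simp add: m_def[symmetric] field_simps)
qed

text \<open>
  The two power means \<open>(a powr p + b powr p) / 2\<close> and \<open>(a\<^sup>2 + b\<^sup>2) / 2\<close> are compared without the outer roots;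
  this is possible since the second one is at least \<open>1\<close>.
\<close>

lemma sum_powr_le_sum_squares:
  fixes a b p :: real
  assumes "0 \<le> a" "0 \<le> b" "0 \<le> p" "p \<le> 2" "2 \<le> a\<^sup>2 + b\<^sup>2"
  shows "a powr p + b powr p \<le> a\<^sup>2 + b\<^sup>2"
proof -
  have sq: "c powr p = (c\<^sup>2) powr (p / 2)" if "0 \<le> c" for c :: real
  proof -
    have "(c\<^sup>2) powr (p / 2) = (c powr 2) powr (p / 2)" using that by simp
    also have "\<dots> = c powr p" unfolding powr_powr by simp
    finally show ?thesis by simp
  qed
  have "a powr p + b powr p \<le> (1 + p / 2 * (a\<^sup>2 - 1)) + (1 + p / 2 * (b\<^sup>2 - 1))"
    unfolding sq[OF assms(1)] sq[OF assms(2)]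
    using assms by (intro add_mono powr_le_tangent_at_1) auto
  also have "\<dots> = 2 + p / 2 * (a\<^sup>2 + b\<^sup>2 - 2)"
    by (simp add: algebra_simps)
  also have "\<dots> \<le> 2 + 1 * (a\<^sup>2 + b\<^sup>2 - 2)"
    using assms by (intro add_left_mono mult_right_mono) auto
  finally show ?thesis by simp
qed

lemma two_le_norm_add_norm_diff:
  fixes x y :: "'a::real_normed_vector"
  assumes "norm x = 1"
  shows "2 \<le> norm (x + y) + norm (x - y)"
proof -
  have "norm (2 *\<^sub>R x) \<le> norm (x + y) + norm (x - y)"
    using norm_triangle_ineq[of "x + y" "x - y"] by (simp add: scaleR_2)
  then show ?thesis using assms by simp
qed

section \<open>Roundness as a parallelogram inequality\<close>

definition roundness_ineq :: "'a::real_normed_vector itself \<Rightarrow> real \<Rightarrow> bool" where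
  "roundness_ineq X p \<longleftrightarrow> (\<forall>x y :: 'a.
     norm (x + y) powr p + norm (x - y) powr p \<le> 2 * (norm x powr p + norm y powr p))"

text \<open>
  The substitution \<open>x \<mapsto> x + y\<close>, \<open>y \<mapsto> x - y\<close> turns coroundness with its constant \<open>2 powr (q - 1)\<close>
  into this inequality, which is the case \<open>K = 1\<close> of uniform convexity.
\<close>

definition coroundness_ineq :: "'a::real_normed_vector itself \<Rightarrow> real \<Rightarrow> bool" where
  "coroundness_ineq X q \<longleftrightarrow> (\<forall>x y :: 'a.
     2 * (norm x powr q + norm y powr q) \<le> norm (x + y) powr q + norm (x - y) powr q)"

text \<open>
  A quadrilateral with consecutive sides \<open>u1, u2, u3, u4\<close> (summing to \<open>0\<close>) has the same diagonals as
  the parallelogram with sides \<open>(u1 - u3) / 2\<close> and \<open>(u2 - u4) / 2\<close>, and by convexity of the power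
  this parallelogram has no larger side sum. So parallelograms are the worst case (Enflo).
\<close>

lemma has_roundness_iff_roundness_ineq:
  assumes "1 \<le> p"
  shows "has_roundness TYPE('a::real_normed_vector) p \<longleftrightarrow> roundness_ineq TYPE('a) p"
proof
  assume *: "has_roundness TYPE('a) p"
  show "roundness_ineq TYPE('a) p"
    unfolding roundness_ineq_def
  proof (intro allI)
    fix x y :: 'a
    have "dist 0 (x + y) powr p + dist x y powr p
        \<le> dist 0 x powr p + dist 0 y powr p + dist (x + y) x powr p + dist (x + y) y powr p"
      using * unfolding has_roundness_def by blast
    then show "norm (x + y) powr p + norm (x - y) powr p \<le> 2 * (norm x powr p + norm y powr p)"
      by (simp add: dist_norm norm_minus_commute add.commute[of y x])
  qed
next
  assume *: "roundness_ineq TYPE('a) p"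
  have half: "norm ((1/2) *\<^sub>R (u - v)) powr p \<le> (norm u powr p + norm v powr p) / 2" for u v :: 'a
  proof -
    have "norm ((1/2) *\<^sub>R (u - v)) powr p \<le> ((norm u + norm v) / 2) powr p"
      using norm_triangle_ineq4[of u v] assms by (intro powr_mono2) auto
    also have "\<dots> \<le> (norm u powr p + norm v powr p) / 2"
      using assms by (intro powr_midpoint_le) auto
    finally show ?thesis .
  qed
  show "has_roundness TYPE('a) p"
    unfolding has_roundness_def
  proof (intro conjI allI)
    show "1 \<le> p" by (rule assms)
    fix a1 a2 b1 b2 :: 'a
    define x where "x = (1/2) *\<^sub>R ((b1 - a1) - (b2 - a2))"
    define y where "y = (1/2) *\<^sub>R ((a2 - b1) - (a1 - b2))"
    have "x + y = a2 - a1"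
      unfolding x_def y_def scaleR_add_right[symmetric]
      by (simp add: algebra_simps) (simp add: scaleR_left_distrib[symmetric])
    moreover have "x - y = b1 - b2"
      unfolding x_def y_def scaleR_diff_right[symmetric]
      by (simp add: algebra_simps) (simp add: scaleR_left_distrib[symmetric])
    ultimately have "dist a1 a2 powr p + dist b1 b2 powr p
        \<le> 2 * (norm x powr p + norm y powr p)"
      using *[unfolded roundness_ineq_def, rule_format, of x y]
      by (simp add: dist_norm norm_minus_commute)
    also have "\<dots> \<le> 2 * ((norm (b1 - a1) powr p + norm (b2 - a2) powr p) / 2
        + (norm (a2 - b1) powr p + norm (a1 - b2) powr p) / 2)"
      unfolding x_def y_def by (intro mult_left_mono add_mono half) auto
    finally show "dist a1 a2 powr p + dist b1 b2 powr p
        \<le> dist a1 b1 powr p + dist a1 b2 powr p + dist a2 b1 powr p + dist a2 b2 powr p"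
      by (simp add: dist_norm norm_minus_commute add_divide_distrib)
  qed
qed

lemma max_roundness_gt_1_iff:
  "max_roundness TYPE('a::real_normed_vector) > 1 \<longleftrightarrow> (\<exists>p>1. roundness_ineq TYPE('a) p)"
proof -
  have "max_roundness TYPE('a) > 1 \<longleftrightarrow> (\<exists>p>1. has_roundness TYPE('a) p)"
  proof
    assume "max_roundness TYPE('a) > 1"
    then show "\<exists>p>1. has_roundness TYPE('a) p"
      unfolding max_roundness_def less_Sup_iff by (auto simp: one_ereal_def)
  next
    assume "\<exists>p>1. has_roundness TYPE('a) p"
    then obtain p where p: "1 < p" "has_roundness TYPE('a) p" by blast
    then have "ereal p \<le> max_roundness TYPE('a)"
      unfolding max_roundness_def by (intro Sup_upper) auto
    moreover have "1 < ereal p" using p by (simp add: one_ereal_def)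
    ultimately show "max_roundness TYPE('a) > 1" by (rule less_le_trans[rotated])
  qed
  then show ?thesis
    by (metis has_roundness_iff_roundness_ineq less_imp_le)
qed

lemma roundness_ineq_imp_le_2:
  assumes "\<exists>x::'a::real_normed_vector. x \<noteq> 0" "roundness_ineq TYPE('a) p"
  shows "p \<le> 2"
proof -
  obtain x :: 'a where "x \<noteq> 0" using assms by blast
  moreover have "norm (x + x) = 2 * norm x"
    by (simp flip: scaleR_2)
  ultimately have "2 powr p \<le> (4::real)"
    using assms(2)[unfolded roundness_ineq_def, rule_format, of x x] by (simp add: powr_mult)
  also have "(4::real) = 2 powr 2" by simp
  finally show ?thesis by (subst (asm) powr_le_cancel_iff) auto
qed

text \<open>By homogeneity and by the symmetry in \<open>x\<close> and \<open>y\<close>, the longer vector can be taken of length \<open>1\<close>.\<close>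

lemma roundness_ineqI_normalized:
  assumes "\<And>x y :: 'a::real_normed_vector. norm x = 1 \<Longrightarrow> norm y \<le> 1 \<Longrightarrow>
      norm (x + y) powr p + norm (x - y) powr p \<le> 2 * (1 + norm y powr p)"
  shows "roundness_ineq TYPE('a) p"
proof -
  have le: "norm (x + y) powr p + norm (x - y) powr p \<le> 2 * (norm x powr p + norm y powr p)"
    if "norm y \<le> norm x" for x y :: 'a
  proof (cases "x = 0")
    case True
    then show ?thesis using that by simp
  next
    case False
    define c where "c = norm x"
    define u v where "u = (1/c) *\<^sub>R x" and "v = (1/c) *\<^sub>R y"
    have c: "c > 0" using False by (simp add: c_def)
    have xy: "x = c *\<^sub>R u" "y = c *\<^sub>R v" using c by (auto simp: u_def v_def)
    have uv: "norm u = 1" "norm v \<le> 1"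
      using c that by (auto simp: u_def v_def c_def)
    have "norm (x + y) = c * norm (u + v)" "norm (x - y) = c * norm (u - v)"
      using c by (auto simp: xy simp flip: scaleR_add_right scaleR_diff_right)
    then have "norm (x + y) powr p + norm (x - y) powr p
        = c powr p * (norm (u + v) powr p + norm (u - v) powr p)"
      by (simp add: powr_mult algebra_simps)
    also have "\<dots> \<le> c powr p * (2 * (1 + norm v powr p))"
      using assms[OF uv] by (intro mult_left_mono) auto
    also have "\<dots> = 2 * (norm x powr p + norm y powr p)"
      using c uv by (simp add: xy powr_mult algebra_simps)
    finally show ?thesis .
  qed
  show ?thesis
    unfolding roundness_ineq_def
  proof (intro allI)
    fix x y :: 'a
    show "norm (x + y) powr p + norm (x - y) powr p \<le> 2 * (norm x powr p + norm y powr p)"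
      using le[of y x] le[of x y]
      by (cases "norm y \<le> norm x") (auto simp: add.commute norm_minus_commute)
  qed
qed

section \<open>Moduli of power type as pointwise inequalities\<close>

lemma smoothness_power_type_iff:
  assumes nz: "\<exists>x::'a::real_normed_vector. x \<noteq> 0" and p: "1 \<le> p"
  shows "smoothness_power_type TYPE('a) p \<longleftrightarrow>
    (\<exists>C>0. \<forall>x y :: 'a. norm x = 1 \<longrightarrow> norm (x + y) + norm (x - y) \<le> 2 + 2 * (C * norm y powr p))"
    (is "_ \<longleftrightarrow> ?R")
proof -
  define S where "S t = {(norm (x + y) + norm (x - y)) / 2 - 1 | x y :: 'a. norm x = 1 \<and> norm y = t}" for t
  obtain e :: 'a where e: "norm e = 1"
    using nz by (metis norm_sgn)
  have bdd: "bdd_above (S t)" for t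
  proof (rule bdd_aboveI)
    fix s assume "s \<in> S t"
    then obtain x y :: 'a where "s = (norm (x + y) + norm (x - y)) / 2 - 1" "norm x = 1" "norm y = t"
      by (auto simp: S_def)
    then show "s \<le> t"
      using norm_triangle_ineq[of x y] norm_triangle_ineq4[of x y] by argo
  qed
  have ne: "S t \<noteq> {}" if "0 \<le> t" for t
  proof -
    have "(norm (e + t *\<^sub>R e) + norm (e - t *\<^sub>R e)) / 2 - 1 \<in> S t"
      using e that unfolding S_def by force
    then show ?thesis by blast
  qed
  have "smoothness_modulus TYPE('a) t \<le> b \<longleftrightarrow>
      (\<forall>x y :: 'a. norm x = 1 \<and> norm y = t \<longrightarrow> norm (x + y) + norm (x - y) \<le> 2 + 2 * b)"
    if "0 \<le> t" for t b
  proof -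
    have "Sup (S t) \<le> b \<longleftrightarrow> (\<forall>s\<in>S t. s \<le> b)"
      by (rule cSup_le_iff[OF ne[OF that] bdd])
    also have "\<dots> \<longleftrightarrow>
      (\<forall>x y :: 'a. norm x = 1 \<and> norm y = t \<longrightarrow> (norm (x + y) + norm (x - y)) / 2 - 1 \<le> b)"
      unfolding S_def by blast
    also have "\<dots> \<longleftrightarrow>
      (\<forall>x y :: 'a. norm x = 1 \<and> norm y = t \<longrightarrow> norm (x + y) + norm (x - y) \<le> 2 + 2 * b)"
    proof -
      have "u / 2 - 1 \<le> b \<longleftrightarrow> u \<le> 2 + 2 * b" for u :: real by argo
      then show ?thesis by simp
    qed
    finally show ?thesis unfolding smoothness_modulus_def S_def .
  qed
  then have "(\<forall>t\<ge>0. smoothness_modulus TYPE('a) t \<le> C * t powr p) \<longleftrightarrow>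
      (\<forall>x y :: 'a. norm x = 1 \<longrightarrow> norm (x + y) + norm (x - y) \<le> 2 + 2 * (C * norm y powr p))" for C
    by auto
  then show ?thesis
    using p unfolding smoothness_power_type_def by simp
qed

text \<open>
  The power type condition leaves out \<open>\<epsilon> = 2\<close>, which antipodal unit vectors attain. Using it at
  \<open>\<epsilon> = norm (x - y) / 2\<close> covers all pairs at the cost of a factor \<open>2 powr q\<close>.
\<close>

lemma convexity_power_type_iff:
  assumes nz: "\<exists>x::'a::real_normed_vector. x \<noteq> 0" and q: "2 \<le> q"
  shows "convexity_power_type TYPE('a) q \<longleftrightarrow>
    (\<exists>C>0. \<forall>x y :: 'a. norm x = 1 \<and> norm y = 1 \<longrightarrow> norm (x + y) / 2 \<le> 1 - C * norm (x - y) powr q)"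
    (is "?L \<longleftrightarrow> ?R")
proof -
  define S where "S \<epsilon> = {1 - norm (x + y) / 2 | x y :: 'a. norm x = 1 \<and> norm y = 1 \<and> norm (x - y) \<ge> \<epsilon>}" for \<epsilon>
  have S: "convexity_modulus TYPE('a) \<epsilon> = Inf (S \<epsilon>)" for \<epsilon>
    unfolding convexity_modulus_def S_def ..
  obtain e :: 'a where e: "norm e = 1"
    using nz by (metis norm_sgn)
  have bdd: "bdd_below (S \<epsilon>)" for \<epsilon>
  proof (rule bdd_belowI)
    fix s assume "s \<in> S \<epsilon>"
    then obtain x y :: 'a where "s = 1 - norm (x + y) / 2" "norm x = 1" "norm y = 1"
      by (auto simp: S_def)
    then show "0 \<le> s"
      using norm_triangle_ineq[of x y] by simp
  qed
  have ne: "S \<epsilon> \<noteq> {}" if "\<epsilon> \<le> 2" for \<epsilon>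
  proof -
    have "norm (e - (- e)) = 2"
      using e by (simp flip: scaleR_2)
    moreover have "norm (- e) = 1" using e by simp
    ultimately have "1 - norm (e + (- e)) / 2 \<in> S \<epsilon>"
      using e that unfolding S_def by (intro CollectI exI[of _ e] exI[of _ "- e"]) auto
    then show ?thesis by blast
  qed
  show ?thesis
  proof
    assume ?L
    then obtain C where C: "C > 0" "\<And>\<epsilon>. 0 \<le> \<epsilon> \<Longrightarrow> \<epsilon> < 2 \<Longrightarrow> C * \<epsilon> powr q \<le> Inf (S \<epsilon>)"
      unfolding convexity_power_type_def S by auto
    show ?R
    proof (intro exI conjI allI impI)
      show "C / 2 powr q > 0" using C by simp
      fix x y :: 'a assume xy: "norm x = 1 \<and> norm y = 1"
      define \<epsilon> where "\<epsilon> = norm (x - y) / 2"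
      have "norm (x - y) \<le> 2" using norm_triangle_ineq4[of x y] xy by simp
      then have eps: "0 \<le> \<epsilon>" "\<epsilon> < 2" "\<epsilon> \<le> norm (x - y)" by (auto simp: \<epsilon>_def)
      have "C * \<epsilon> powr q \<le> Inf (S \<epsilon>)" using C eps by blast
      also have "\<dots> \<le> 1 - norm (x + y) / 2"
        using xy eps by (intro cInf_lower bdd) (auto simp: S_def)
      finally show "norm (x + y) / 2 \<le> 1 - C / 2 powr q * norm (x - y) powr q"
        by (simp add: \<epsilon>_def powr_divide)
    qed
  next
    assume ?R
    then obtain C where C: "C > 0" "\<And>x y :: 'a. norm x = 1 \<Longrightarrow> norm y = 1 \<Longrightarrow>
        norm (x + y) / 2 \<le> 1 - C * norm (x - y) powr q" by blast
    have "C * \<epsilon> powr q \<le> Inf (S \<epsilon>)" if eps: "0 \<le> \<epsilon>" "\<epsilon> < 2" for \<epsilon>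
    proof (rule cInf_greatest)
      show "S \<epsilon> \<noteq> {}" using ne eps by simp
      fix s assume "s \<in> S \<epsilon>"
      then obtain x y :: 'a where xy: "s = 1 - norm (x + y) / 2" "norm x = 1" "norm y = 1"
        "\<epsilon> \<le> norm (x - y)" by (auto simp: S_def)
      have "C * \<epsilon> powr q \<le> C * norm (x - y) powr q"
        using C(1) eps xy q by (intro mult_left_mono powr_mono2) auto
      then show "C * \<epsilon> powr q \<le> s"
        using C(2)[OF xy(2,3)] xy(1) by simp
    qed
    then show ?L
      using q C(1) unfolding convexity_power_type_def S by auto
  qed
qed

section \<open>From roundness to smoothness and back\<close>

lemma roundness_ineq_imp_uniformly_smooth:
  assumes "\<exists>x::'a::real_normed_vector. x \<noteq> 0" "1 \<le> p" "roundness_ineq TYPE('a) p"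
  shows "uniformly_smooth TYPE('a) p"
  using assms roundness_ineq_imp_le_2[OF assms(1,3)]
  unfolding uniformly_smooth_def roundness_ineq_def by (auto intro!: exI[of _ 1])

text \<open>
  The mean \<open>m \<ge> 1\<close> of \<open>norm (x + y)\<close> and \<open>norm (x - y)\<close> satisfies \<open>m \<le> m powr p\<close>, which convexity
  bounds by the mean of the powers.
\<close>

lemma uniformly_smooth_imp_smoothness_power_type:
  assumes nz: "\<exists>x::'a::real_normed_vector. x \<noteq> 0" and us: "uniformly_smooth TYPE('a) p"
  shows "smoothness_power_type TYPE('a) p"
proof -
  obtain K where p: "1 \<le> p" and K: "K > 0" "\<And>x y :: 'a. norm (x + y) powr p + norm (x - y) powr p
        \<le> 2 * (norm x powr p + norm (K *\<^sub>R y) powr p)"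
    using us unfolding uniformly_smooth_def by blast
  have "norm (x + y) + norm (x - y) \<le> 2 + 2 * (K powr p * norm y powr p)" if x: "norm x = 1" for x y :: 'a
  proof -
    define m where "m = (norm (x + y) + norm (x - y)) / 2"
    have "1 \<le> m" using two_le_norm_add_norm_diff[OF x, of y] by (simp add: m_def)
    then have "m \<le> m powr p" using powr_mono[of 1 p m] p by simp
    also have "\<dots> \<le> (norm (x + y) powr p + norm (x - y) powr p) / 2"
      unfolding m_def using p by (intro powr_midpoint_le) auto
    also have "\<dots> \<le> 1 + K powr p * norm y powr p"
      using K(2)[of x y] K(1) x by (simp add: powr_mult)
    finally show ?thesis by (simp add: m_def)
  qed
  then show ?thesis
    unfolding smoothness_power_type_iff[OF nz p] using K(1) by (intro exI[of _ "K powr p"]) auto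
qed

text \<open>
  This is the step that removes the constant \<open>C\<close> in exchange for a smaller exponent. Let \<open>norm x = 1\<close> and
  \<open>t = norm y \<le> 1\<close>; the claim compares \<open>norm (x + y) powr p + norm (x - y) powr p\<close> with \<open>2 + 2 * t powr p\<close>.
  Below a threshold \<open>t0\<close> the comparison holds for all \<open>p \<le> (1 + r) / 2\<close>,
  where \<open>r \<le> 2\<close> is the given exponent, capped: the left-hand side exceeds
  \<open>2\<close> by \<open>O(t powr r)\<close> only, and \<open>t powr r\<close> is negligible against \<open>t powr p\<close>. Above \<open>t0\<close> the case
  \<open>p = 1\<close> holds with a uniform gap \<open>\<eta>\<close>: the bound \<open>norm (x + y) + norm (x - y) \<le> 2 + 2 * t - 2 * \<eta>\<close>
  at \<open>t = t0\<close> propagates to larger \<open>t\<close> by the triangle inequality. The gap leaves room for an exponent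
  slightly above \<open>1\<close>.
\<close>

lemma smoothness_power_type_imp_roundness_ineq:
  assumes nz: "\<exists>x::'a::real_normed_vector. x \<noteq> 0"
    and r0: "1 < r0" and sm: "smoothness_power_type TYPE('a) r0"
  shows "\<exists>p>1. roundness_ineq TYPE('a) p"
proof -
  obtain C where C: "C > 0" and C0: "\<And>x y :: 'a. norm x = 1 \<Longrightarrow>
      norm (x + y) + norm (x - y) \<le> 2 + 2 * (C * norm y powr r0)"
    using sm smoothness_power_type_iff[OF nz, of r0] r0 by auto
  define r where "r = min r0 2"
  have r: "1 < r" "r \<le> 2" using r0 by (auto simp: r_def)
  have Cr: "norm (x + y) + norm (x - y) \<le> 2 + 2 * (C * norm y powr r)"
    if "norm x = 1" "norm y \<le> 1" for x y :: 'a
  proof -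
    have "norm y powr r0 \<le> norm y powr r" using that by (intro powr_mono') (auto simp: r_def)
    then have "C * norm y powr r0 \<le> C * norm y powr r" using C by simp
    then show ?thesis using C0[OF that(1), of y] by linarith
  qed
  \<comment> \<open>The threshold solves \<open>(C + 1)\<^sup>2 * t0 powr ((r - 1) / 2) = 1\<close>.\<close>
  define t0 where "t0 = (C + 1) powr (- 4 / (r - 1))"
  have t0_root: "t0 powr ((r - 1) / 2) = 1 / (C + 1)\<^sup>2"
  proof -
    have "(- 4 / (r - 1)) * ((r - 1) / 2) = - 2" using r by (simp add: divide_simps)
    then have "t0 powr ((r - 1) / 2) = (C + 1) powr (- 2)"
      unfolding t0_def powr_powr by simp
    also have "\<dots> = 1 / (C + 1)\<^sup>2"
      using C by (intro powr_neg_numeral) simp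
    finally show ?thesis .
  qed
  have t0: "0 < t0" "t0 < 1"
  proof -
    show "0 < t0" using C by (simp add: t0_def)
    have "(C + 1) powr (- 4 / (r - 1)) < (C + 1) powr 0"
      using C r by (intro powr_less_mono) (auto simp: field_simps)
    then show "t0 < 1" using C by (simp add: t0_def)
  qed
  have small: "(C + 1)\<^sup>2 * t powr r \<le> t powr p" if t: "0 \<le> t" "t \<le> t0" and p: "p \<le> (1 + r) / 2" for t p
  proof -
    have "t powr r = t powr p * t powr (r - p)" by (simp flip: powr_add)
    also have "\<dots> \<le> t powr p * t powr ((r - 1) / 2)"
      using t t0 p by (intro mult_left_mono powr_mono') (auto simp: field_simps)
    also have "\<dots> \<le> t powr p * t0 powr ((r - 1) / 2)"
      using t r by (intro mult_left_mono powr_mono2) auto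
    also have "\<dots> = t powr p / (C + 1)\<^sup>2"
      by (simp add: t0_root)
    finally have "t powr r \<le> t powr p / (C + 1)\<^sup>2" .
    moreover have "0 < (C + 1)\<^sup>2" using C by simp
    ultimately show ?thesis by (simp add: pos_le_divide_eq mult.commute)
  qed
  define \<eta> where "\<eta> = t0 - C * t0 powr r"
  have eta: "0 < \<eta>" "\<eta> < 1"
  proof -
    have "0 < 1 + C + C * C" using C by (intro add_pos_pos) auto
    then have "C < (C + 1)\<^sup>2" by (simp add: power2_eq_square algebra_simps)
    then have "C * t0 powr r < (C + 1)\<^sup>2 * t0 powr r"
      using t0 by (intro mult_strict_right_mono) auto
    also have "\<dots> \<le> t0 powr 1" using small[of t0 1] t0 r by simp
    finally show "0 < \<eta>" using t0 by (simp add: \<eta>_def)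
    have "0 \<le> C * t0 powr r" using C by simp
    then show "\<eta> < 1" using t0 unfolding \<eta>_def by linarith
  qed
  \<comment> \<open>The second entry is the largest exponent \<open>d\<close> with \<open>(2 / t0) powr d * (1 - \<eta> / 2) \<le> 1\<close>.\<close>
  define d where "d = min ((r - 1) / 2) (log (2 / t0) (1 / (1 - \<eta> / 2)))"
  define p where "p = 1 + d"
  have base: "1 < 2 / t0" using t0 by simp
  have d: "0 < d"
    using r eta base by (auto simp: d_def)
  have p: "1 < p" "p \<le> (1 + r) / 2" "p \<le> 2"
  proof -
    have "d \<le> (r - 1) / 2" unfolding d_def by (rule min.cobounded1)
    then show "1 < p" "p \<le> (1 + r) / 2" "p \<le> 2" using d r unfolding p_def by argo+
  qed
  have room: "(2 / t0) powr d * (1 - \<eta> / 2) \<le> 1"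
  proof -
    have "(2 / t0) powr d \<le> (2 / t0) powr log (2 / t0) (1 / (1 - \<eta> / 2))"
      using base by (intro powr_mono) (auto simp: d_def)
    also have "\<dots> = 1 / (1 - \<eta> / 2)"
      using base eta t0 by (intro powr_log_cancel) auto
    finally show ?thesis using eta by (simp add: field_simps)
  qed
  have "roundness_ineq TYPE('a) p"
  proof (rule roundness_ineqI_normalized)
    fix x y :: 'a assume x: "norm x = 1" and y: "norm y \<le> 1"
    define t where "t = norm y"
    define a b where "a = norm (x + y)" and "b = norm (x - y)"
    have ab: "0 \<le> a" "0 \<le> b" "a \<le> 1 + t" "b \<le> 1 + t"
      using norm_triangle_ineq[of x y] norm_triangle_ineq4[of x y] x
      by (auto simp: a_def b_def t_def)
    have t: "0 \<le> t" "t \<le> 1" using y by (auto simp: t_def)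
    have ab2: "2 \<le> a + b"
      using two_le_norm_add_norm_diff[OF x, of y] by (simp add: a_def b_def)
    have "a powr p + b powr p \<le> 2 * (1 + t powr p)"
    proof (cases "t \<le> t0")
      case True
      define m where "m = (a + b) / 2"
      define h where "h = (a - b) / 2"
      have sq: "a\<^sup>2 + b\<^sup>2 = 2 * (m\<^sup>2 + h\<^sup>2)"
        by (simp add: m_def h_def power2_eq_square field_simps)
      have m: "1 \<le> m" "m \<le> 1 + C * t powr r"
        using ab2 Cr[OF x y] by (auto simp: m_def a_def b_def t_def)
      have "a - b \<le> 2 * t" "b - a \<le> 2 * t"
      proof -
        have "x + y = (x - y) + 2 *\<^sub>R y" "x - y = (x + y) - 2 *\<^sub>R y"
          by (auto simp: scaleR_2 algebra_simps)
        then have "norm (x + y) \<le> norm (x - y) + norm (2 *\<^sub>R y)"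
          "norm (x - y) \<le> norm (x + y) + norm (2 *\<^sub>R y)"
          by (metis norm_triangle_ineq, metis norm_triangle_ineq4)
        then show "a - b \<le> 2 * t" "b - a \<le> 2 * t" by (auto simp: a_def b_def t_def)
      qed
      then have "h\<^sup>2 \<le> t\<^sup>2" by (intro abs_le_square_iff[THEN iffD1]) (simp add: h_def t_def)
      also have "\<dots> \<le> t powr r"
        using powr_mono'[of r 2 t] t r by simp
      finally have h: "h\<^sup>2 \<le> t powr r" .
      define s where "s = t powr r"
      have s: "0 \<le> s" "s \<le> 1" using t r by (auto simp: s_def intro: powr_le1)
      have "m\<^sup>2 \<le> (1 + C * s)\<^sup>2" using m by (intro power_mono) (auto simp: s_def)
      also have "\<dots> = 1 + 2 * C * s + C\<^sup>2 * (s * s)"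
        by (simp add: power2_eq_square algebra_simps)
      also have "\<dots> \<le> 1 + 2 * C * s + C\<^sup>2 * (s * 1)"
        using s by (intro add_left_mono mult_left_mono) auto
      finally have "m\<^sup>2 + h\<^sup>2 \<le> 1 + 2 * C * s + C\<^sup>2 * s + s"
        using h by (simp add: s_def)
      also have "\<dots> = 1 + (C + 1)\<^sup>2 * s"
        by (simp add: power2_eq_square algebra_simps)
      also have "\<dots> \<le> 1 + t powr p"
        using small[OF t(1) True p(2)] by (simp add: s_def)
      finally have le: "m\<^sup>2 + h\<^sup>2 \<le> 1 + t powr p" .
      have "1 \<le> m\<^sup>2" using m by simp
      then have "1 \<le> m\<^sup>2 + h\<^sup>2" by (simp add: add_increasing2)
      then have "a powr p + b powr p \<le> a\<^sup>2 + b\<^sup>2"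
        using ab p by (intro sum_powr_le_sum_squares) (auto simp: sq)
      then show ?thesis using le sq by argo
    next
      case False
      define z where "z = (t0 / t) *\<^sub>R y"
      have tpos: "0 < t" "t0 < t" using False t0 by auto
      have z: "norm z = t0" "norm (y - z) = t - t0"
      proof -
        show "norm z = t0" using tpos t0 by (simp add: z_def t_def)
        have "y - z = (1 - t0 / t) *\<^sub>R y" by (simp add: z_def algebra_simps)
        then have "norm (y - z) = (1 - t0 / t) * t" using tpos by (simp add: t_def)
        also have "\<dots> = t - t0" using tpos by (simp add: algebra_simps)
        finally show "norm (y - z) = t - t0" .
      qed
      have "a \<le> norm (x + z) + (t - t0)" "b \<le> norm (x - z) + (t - t0)"
        using norm_triangle_ineq[of "x + z" "y - z"] norm_triangle_ineq4[of "x - z" "y - z"] z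
        by (auto simp: a_def b_def)
      moreover have "norm (x + z) + norm (x - z) \<le> 2 + 2 * (C * t0 powr r)"
        using Cr[OF x, of z] z t0 by simp
      ultimately have gap: "a + b \<le> 2 * (1 + t - \<eta>)" by (simp add: \<eta>_def)
      have pow: "c powr p \<le> 2 powr d * c" if "0 \<le> c" "c \<le> 1 + t" for c
      proof -
        have "c powr p = c powr d * c"
          using that by (simp add: p_def powr_mult_base mult.commute)
        also have "\<dots> \<le> 2 powr d * c"
          using that t d by (intro mult_right_mono powr_mono2) auto
        finally show ?thesis .
      qed
      have "a powr p + b powr p \<le> 2 powr d * a + 2 powr d * b"
        using pow ab by (intro add_mono) auto
      also have "\<dots> = 2 powr d * (a + b)" by (simp add: algebra_simps)
      also have "\<dots> \<le> 2 powr d * (2 * (1 + t - \<eta>))"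
        using gap by (intro mult_left_mono) auto
      also have "\<dots> \<le> 2 powr d * (2 * ((1 - \<eta> / 2) * (1 + t)))"
      proof -
        have "\<eta> / 2 * (1 + t) \<le> \<eta> / 2 * 2" using t eta by (intro mult_left_mono) auto
        then show ?thesis by (intro mult_left_mono) (auto simp: algebra_simps)
      qed
      also have "\<dots> = 2 * (t0 powr d * ((2 / t0) powr d * (1 - \<eta> / 2)) * (1 + t))"
        using t0 by (simp add: powr_divide)
      also have "\<dots> \<le> 2 * (t0 powr d * 1 * (1 + t))"
        using t room by (intro mult_left_mono mult_right_mono) auto
      also have "\<dots> \<le> 2 * (1 + t powr p)"
      proof -
        have "t0 powr d \<le> 1" using t0 d by (intro powr_le1) auto
        moreover have "t0 powr d * t \<le> t powr d * t"
          using t0 tpos d by (intro mult_right_mono powr_mono2) auto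
        moreover have "t powr d * t = t powr p"
          using t by (simp add: p_def powr_mult_base mult.commute)
        ultimately show ?thesis by (simp add: algebra_simps)
      qed
      finally show ?thesis .
    qed
    then show "norm (x + y) powr p + norm (x - y) powr p \<le> 2 * (1 + norm y powr p)"
      by (simp add: a_def b_def t_def)
  qed
  then show ?thesis using p by blast
qed

section \<open>Smoothness and the expansion of the norm\<close>

lemma support_map_unit:
  assumes "support_map f" "norm x = 1"
  shows "norm (f x) = 1" "blinfun_apply (f x) x = 1"
  using assms unfolding support_map_def by auto

lemma blinfun_apply_le_norm:
  fixes g :: "'a::real_normed_vector \<Rightarrow>\<^sub>L real"
  shows "blinfun_apply g x \<le> norm g * norm x"
  using norm_blinfun[of g x] by simp

text \<open>
  The remainders at \<open>t\<close> and \<open>- t\<close> are both nonnegative, since \<open>f x\<close> supports the ball at \<open>x\<close>, and their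
  sum is the second difference of the norm that the modulus of smoothness controls.
\<close>

lemma smoothness_power_type_imp_uniform_norm_expansion:
  fixes f :: "'a::real_normed_vector \<Rightarrow> ('a \<Rightarrow>\<^sub>L real)"
  assumes nz: "\<exists>x::'a. x \<noteq> 0" and supp: "support_map f"
    and p: "1 \<le> p" and sm: "smoothness_power_type TYPE('a) p"
  shows "uniform_norm_expansion f p"
proof -
  obtain C where C: "C > 0" "\<And>x y :: 'a. norm x = 1 \<Longrightarrow>
      norm (x + y) + norm (x - y) \<le> 2 + 2 * (C * norm y powr p)"
    using sm smoothness_power_type_iff[OF nz p] by auto
  have "\<bar>norm (x + t *\<^sub>R y) - 1 - blinfun_apply (f x) y * t\<bar> \<le> (2 * C) * \<bar>t\<bar> powr p"
    if x: "norm x = 1" and y: "norm y = 1" for x y t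
  proof -
    have lower: "1 + blinfun_apply (f x) y * s \<le> norm (x + s *\<^sub>R y)" for s
      using blinfun_apply_le_norm[of "f x" "x + s *\<^sub>R y"] support_map_unit[OF supp x]
      by (simp add: blinfun.add_right blinfun.scaleR_right mult.commute)
    have "norm (x + t *\<^sub>R y) + norm (x + (- t) *\<^sub>R y) \<le> 2 + 2 * (C * \<bar>t\<bar> powr p)"
      using C(2)[OF x, of "t *\<^sub>R y"] y by simp
    then show ?thesis using lower[of t] lower[of "- t"] by simp
  qed
  then show ?thesis
    unfolding uniform_norm_expansion_def using C(1) by (intro exI[of _ "2 * C"] exI[of _ 1] conjI) auto
qed

lemma uniform_norm_expansion_imp_smoothness_power_type:
  fixes f :: "'a::real_normed_vector \<Rightarrow> ('a \<Rightarrow>\<^sub>L real)"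
  assumes nz: "\<exists>x::'a. x \<noteq> 0" and r: "1 \<le> r" and ex: "uniform_norm_expansion f r"
  shows "smoothness_power_type TYPE('a) r"
proof -
  obtain C t0 where C: "C > 0" "t0 > 0"
    and expand: "\<And>t x y. \<bar>t\<bar> < t0 \<Longrightarrow> norm x = 1 \<Longrightarrow> norm y = 1 \<Longrightarrow>
        \<bar>norm (x + t *\<^sub>R y) - 1 - blinfun_apply (f x) y * t\<bar> \<le> C * \<bar>t\<bar> powr r"
    using ex unfolding uniform_norm_expansion_def by blast
  \<comment> \<open>Beyond \<open>t0\<close> the second summand takes over, from the trivial bound \<open>norm y \<le> t0 powr (1 - r) * norm y powr r\<close>.\<close>
  define D where "D = C + t0 powr (1 - r)"
  have D: "D > 0" using C by (simp add: D_def add_pos_pos)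
  have "norm (x + y) + norm (x - y) \<le> 2 + 2 * (D * norm y powr r)" if x: "norm x = 1" for x y :: 'a
  proof (cases "y = 0")
    case True
    then show ?thesis using x by simp
  next
    case False
    define t where "t = norm y"
    have t: "0 < t" using False by (simp add: t_def)
    have "(norm (x + y) + norm (x - y)) / 2 \<le> 1 + D * t powr r"
    proof (cases "t < t0")
      case True
      define u where "u = (1 / t) *\<^sub>R y"
      have u: "norm u = 1" "y = t *\<^sub>R u" using t by (auto simp: u_def t_def)
      have "norm (x + y) + norm (x - y) \<le> 2 + 2 * (C * t powr r)"
        using expand[OF _ x u(1), of t] expand[OF _ x u(1), of "- t"] t True
        by (simp add: u(2)[symmetric])
      moreover have "C * t powr r \<le> D * t powr r"
        by (intro mult_right_mono) (auto simp: D_def)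
      ultimately show ?thesis by simp
    next
      case False
      have "t = t powr (1 - r) * t powr r" using t by (simp flip: powr_add)
      also have "\<dots> \<le> t0 powr (1 - r) * t powr r"
        using False C t r by (intro mult_right_mono powr_mono2') auto
      also have "\<dots> \<le> D * t powr r"
        using C by (intro mult_right_mono) (auto simp: D_def)
      finally have "t \<le> D * t powr r" .
      then show ?thesis
        using norm_triangle_ineq[of x y] norm_triangle_ineq4[of x y] x by (simp add: t_def)
    qed
    then show ?thesis by (simp add: t_def field_simps)
  qed
  then show ?thesis
    unfolding smoothness_power_type_iff[OF nz r] using D by auto
qed

section \<open>Convexity of the dual\<close>

lemma exists_nonneg_near_norm:
  fixes g :: "'a::real_normed_vector \<Rightarrow>\<^sub>L real"
  assumes "e > 0"
  shows "\<exists>u. norm u \<le> 1 \<and> 0 \<le> blinfun_apply g u \<and> norm g - e \<le> blinfun_apply g u"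
proof (rule ccontr)
  assume no: "\<not> ?thesis"
  have "e < norm g"
    using no[unfolded not_ex, rule_format, of 0] by auto
  moreover have "norm (blinfun_apply g x) \<le> (norm g - e) * norm x" for x
  proof (cases "x = 0")
    case True
    then show ?thesis by simp
  next
    case False
    define u where "u = (sgn (blinfun_apply g x) / norm x) *\<^sub>R x"
    have "norm u \<le> 1" using False by (simp add: u_def abs_sgn_eq)
    moreover have gu: "blinfun_apply g u = \<bar>blinfun_apply g x\<bar> / norm x"
      by (simp add: u_def blinfun.scaleR_right sgn_mult_self_eq abs_sgn mult.commute)
    moreover have "0 \<le> blinfun_apply g u" using gu by simp
    ultimately have "blinfun_apply g u < norm g - e"
      using no by (meson not_le)
    then show ?thesis using gu False by (simp add: field_simps)
  qed
  ultimately have "norm g \<le> norm g - e"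
    by (intro norm_blinfun_bound) auto
  then show False using assms by simp
qed

text \<open>
  Write \<open>g x + h y\<close> as half of \<open>(g + h) (x + y) + (g - h) (x - y)\<close>, apply Young's inequality to both
  terms and the roundness of the space to \<open>x\<close> and \<open>y\<close>. When \<open>x\<close> and \<open>y\<close> nearly norm \<open>g\<close> and \<open>h\<close> and
  have lengths \<open>norm g powr (q - 1)\<close> and \<open>norm h powr (q - 1)\<close>, the left-hand side is nearly
  \<open>norm g powr q + norm h powr q\<close>, and so is \<open>norm x powr p + norm y powr p\<close>.
\<close>

lemma roundness_ineq_imp_coroundness_ineq_dual:
  assumes p: "1 < p" and round: "roundness_ineq TYPE('a::real_normed_vector) p"
    and q: "q = p / (p - 1)"
  shows "coroundness_ineq TYPE('a \<Rightarrow>\<^sub>L real) q"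
  unfolding coroundness_ineq_def
proof (intro allI)
  fix g h :: "'a \<Rightarrow>\<^sub>L real"
  have conj: "1 / q + 1 / p = 1" "1 < q" "(q - 1) * p = q"
    using p by (auto simp: q field_simps)
  define N where "N = norm (g + h) powr q + norm (g - h) powr q"
  have near: "2 * (a powr q + b powr q) \<le> N"
    if u: "norm u \<le> 1" "blinfun_apply g u = a" "0 \<le> a"
      and v: "norm v \<le> 1" "blinfun_apply h v = b" "0 \<le> b" for u v a b
  proof -
    define x y where "x = a powr (q - 1) *\<^sub>R u" and "y = b powr (q - 1) *\<^sub>R v"
    define S where "S = a powr q + b powr q"
    have len: "norm (c powr (q - 1) *\<^sub>R w) powr p \<le> c powr q" if "norm w \<le> 1" for c and w :: 'a
    proof -
      have "norm (c powr (q - 1) *\<^sub>R w) powr p \<le> (c powr (q - 1)) powr p"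
        using that p by (intro powr_mono2) (auto simp: mult_left_le)
      also have "\<dots> = c powr q" unfolding powr_powr conj ..
      finally show ?thesis .
    qed
    have xy: "norm x powr p + norm y powr p \<le> S"
      unfolding S_def x_def y_def using u v by (intro add_mono len) auto
    have young: "blinfun_apply k z \<le> norm k powr q / q + norm z powr p / p" for k :: "'a \<Rightarrow>\<^sub>L real" and z
      using blinfun_apply_le_norm[of k z] Youngs_inequality[of q p "norm k" "norm z"] conj p by simp
    have "S = blinfun_apply g x + blinfun_apply h y"
      using u v powr_mult_base[of a "q - 1"] powr_mult_base[of b "q - 1"]
      by (simp add: S_def x_def y_def blinfun.scaleR_right mult.commute)
    also have "2 * \<dots> = blinfun_apply (g + h) (x + y) + blinfun_apply (g - h) (x - y)"
      by (simp add: blinfun.bilinear_simps)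
    also have "\<dots> \<le> (norm (g + h) powr q / q + norm (x + y) powr p / p)
        + (norm (g - h) powr q / q + norm (x - y) powr p / p)"
      by (intro add_mono young)
    also have "\<dots> = N / q + (norm (x + y) powr p + norm (x - y) powr p) / p"
      by (simp add: N_def add_divide_distrib)
    also have "\<dots> \<le> N / q + (2 * S) / p"
    proof (intro add_left_mono divide_right_mono)
      have "norm (x + y) powr p + norm (x - y) powr p \<le> 2 * (norm x powr p + norm y powr p)"
        using round unfolding roundness_ineq_def by blast
      also have "\<dots> \<le> 2 * S" using xy by simp
      finally show "norm (x + y) powr p + norm (x - y) powr p \<le> 2 * S" .
    qed (use p in auto)
    finally have "2 * S * (1 - 1 / p) \<le> N / q" by (simp add: algebra_simps)
    moreover have "1 - 1 / p = 1 / q" using conj by simp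
    ultimately have "2 * S / q \<le> N / q" by simp
    then show ?thesis using conj by (simp add: S_def divide_le_cancel)
  qed
  have approx: "2 * (max 0 (norm g - e) powr q + max 0 (norm h - e) powr q) \<le> N" if e: "e > 0" for e
  proof -
    obtain u v where u: "norm u \<le> 1" "0 \<le> blinfun_apply g u" "norm g - e \<le> blinfun_apply g u"
      and v: "norm v \<le> 1" "0 \<le> blinfun_apply h v" "norm h - e \<le> blinfun_apply h v"
      using exists_nonneg_near_norm[OF e] by metis
    have "2 * (max 0 (norm g - e) powr q + max 0 (norm h - e) powr q)
        \<le> 2 * (blinfun_apply g u powr q + blinfun_apply h v powr q)"
      using u v conj by (intro mult_left_mono add_mono powr_mono2) auto
    also have "\<dots> \<le> N" using near u v by blast
    finally show ?thesis .
  qed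
  have "((\<lambda>e. 2 * (max 0 (norm g - e) powr q + max 0 (norm h - e) powr q))
      \<longlongrightarrow> 2 * (max 0 (norm g - 0) powr q + max 0 (norm h - 0) powr q)) (at_right 0)"
    using conj by (intro tendsto_intros tendsto_powr') auto
  then have "2 * (max 0 (norm g - 0) powr q + max 0 (norm h - 0) powr q) \<le> N"
    by (rule tendsto_upperbound)
      (use approx in \<open>auto intro!: eventually_mono[OF eventually_at_right_less[of 0]]\<close>)
  then show "2 * (norm g powr q + norm h powr q)
      \<le> norm (g + h) powr q + norm (g - h) powr q"
    by (simp add: N_def max_def)
qed

text \<open>
  The vector \<open>y = 0\<close> shows \<open>nu_const X q \<ge> 2\<close>, which rules out \<open>q < 2\<close>; \<open>y = x\<close> shows
  \<open>nu_const X q \<ge> 2 powr (q - 1)\<close>, so that equality is the upper bound alone.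
\<close>

lemma nu_const_eq_iff:
  assumes nz: "\<exists>x::'a::real_normed_vector. x \<noteq> 0" and q: "1 \<le> q"
  shows "nu_const TYPE('a) q = 2 powr (q - 1) \<longleftrightarrow> 2 \<le> q \<and> coroundness_ineq TYPE('a) q"
proof -
  define Q where "Q x y = (norm (x + y) powr q + norm (x - y) powr q) / (norm x powr q + norm y powr q)"
    for x y :: 'a
  define S where "S = {Q x y | x y. x \<noteq> 0 \<or> y \<noteq> 0}"
  have nu: "nu_const TYPE('a) q = Sup S"
    unfolding nu_const_def S_def Q_def ..
  obtain e :: 'a where e: "norm e = 1" "e \<noteq> 0"
    using nz by (metis norm_sgn norm_zero zero_neq_one)
  have den: "0 < norm x powr q + norm y powr q" if "x \<noteq> 0 \<or> y \<noteq> 0" for x y :: 'a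
    using that by (auto intro: add_pos_nonneg add_nonneg_pos)
  have bdd: "bdd_above S"
  proof (rule bdd_aboveI)
    fix s assume "s \<in> S"
    then obtain x y :: 'a where s: "s = Q x y" "x \<noteq> 0 \<or> y \<noteq> 0" by (auto simp: S_def)
    have bound: "norm z powr q \<le> 2 powr q * ((norm x powr q + norm y powr q) / 2)"
      if "norm z \<le> norm x + norm y" for z :: 'a
    proof -
      have "norm z powr q \<le> (2 * ((norm x + norm y) / 2)) powr q"
        using that q by (intro powr_mono2) auto
      also have "\<dots> = 2 powr q * ((norm x + norm y) / 2) powr q" by (rule powr_mult)
      also have "\<dots> \<le> 2 powr q * ((norm x powr q + norm y powr q) / 2)"
        using q by (intro mult_left_mono powr_midpoint_le) auto
      finally show ?thesis .
    qed
    have "norm (x + y) powr q + norm (x - y) powr q \<le> 2 powr q * (norm x powr q + norm y powr q)"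
      using bound[OF norm_triangle_ineq] bound[OF norm_triangle_ineq4] by simp
    then show "s \<le> 2 powr q"
      using den[OF s(2)] unfolding s(1) Q_def by (simp add: pos_divide_le_eq)
  qed
  have two: "norm (z + z) = 2 * norm z" for z :: 'a by (simp flip: scaleR_2)
  have "Q e e = 2 powr (q - 1)"
    using e by (simp add: Q_def two powr_diff)
  then have ee: "2 powr (q - 1) \<in> S" using e unfolding S_def by (intro CollectI exI[of _ e]) auto
  have "Q e 0 = 2"
    using e by (simp add: Q_def)
  then have e0: "2 \<in> S" using e unfolding S_def by (intro CollectI exI[of _ e] exI[of _ 0]) auto
  have "coroundness_ineq TYPE('a) q \<longleftrightarrow> (\<forall>s\<in>S. s \<le> 2 powr (q - 1))"
  proof
    assume co: "coroundness_ineq TYPE('a) q"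
    show "\<forall>s\<in>S. s \<le> 2 powr (q - 1)"
    proof
      fix s assume "s \<in> S"
      then obtain x y :: 'a where s: "s = Q x y" "x \<noteq> 0 \<or> y \<noteq> 0" by (auto simp: S_def)
      have "norm ((x + y) + (x - y)) = 2 * norm x" "norm ((x + y) - (x - y)) = 2 * norm y"
        using two by (auto simp: algebra_simps)
      then have "2 * (norm (x + y) powr q + norm (x - y) powr q)
          \<le> 2 powr q * (norm x powr q + norm y powr q)"
        using co[unfolded coroundness_ineq_def, rule_format, of "x + y" "x - y"]
        by (simp add: powr_mult algebra_simps)
      then show "s \<le> 2 powr (q - 1)"
        using den[OF s(2)] unfolding s(1) Q_def by (simp add: pos_divide_le_eq powr_diff)
    qed
  next
    assume le: "\<forall>s\<in>S. s \<le> 2 powr (q - 1)"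
    show "coroundness_ineq TYPE('a) q"
      unfolding coroundness_ineq_def
    proof (intro allI)
      fix x y :: 'a
      show "2 * (norm x powr q + norm y powr q) \<le> norm (x + y) powr q + norm (x - y) powr q"
      proof (cases "x = 0 \<and> y = 0")
        case True
        then show ?thesis by simp
      next
        case False
        have sum_diff: "(x + y) + (x - y) = x + x" "(x + y) - (x - y) = y + y"
          by (auto simp: algebra_simps)
        have nz': "x + y \<noteq> 0 \<or> x - y \<noteq> 0"
        proof (rule ccontr)
          assume "\<not> ?thesis"
          then have "x + x = 0" "y + y = 0" using sum_diff by auto
          then show False using False two[of x] two[of y] by auto
        qed
        then have "Q (x + y) (x - y) \<le> 2 powr (q - 1)" using le unfolding S_def by blast
        then have "norm (x + x) powr q + norm (y + y) powr q
            \<le> 2 powr (q - 1) * (norm (x + y) powr q + norm (x - y) powr q)"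
          using den[OF nz'] unfolding Q_def sum_diff by (simp add: pos_divide_le_eq)
        then have "2 powr q * (2 * (norm x powr q + norm y powr q))
            \<le> 2 powr q * (norm (x + y) powr q + norm (x - y) powr q)"
          by (simp add: two powr_mult powr_diff algebra_simps)
        then show ?thesis by (subst (asm) mult_le_cancel_left_pos) auto
      qed
    qed
  qed
  also have "\<dots> \<longleftrightarrow> Sup S \<le> 2 powr (q - 1)"
    using cSup_le_iff[OF _ bdd] ee by blast
  also have "\<dots> \<longleftrightarrow> Sup S = 2 powr (q - 1)"
    using cSup_upper[OF ee bdd] by auto
  finally have co: "coroundness_ineq TYPE('a) q \<longleftrightarrow> Sup S = 2 powr (q - 1)" .
  moreover have "2 \<le> q" if "Sup S = 2 powr (q - 1)"
  proof -
    have "2 powr 1 \<le> (2::real) powr (q - 1)"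
      using cSup_upper[OF e0 bdd] that by simp
    then have "1 \<le> q - 1" by (subst (asm) powr_le_cancel_iff) auto
    then show ?thesis by simp
  qed
  ultimately show ?thesis using nu by auto
qed

lemma min_coroundness_less_infinity_iff:
  assumes nz: "\<exists>x::'a::real_normed_vector. x \<noteq> 0"
  shows "min_coroundness TYPE('a) < \<infinity> \<longleftrightarrow> (\<exists>q\<ge>2. coroundness_ineq TYPE('a) q)"
proof -
  have "min_coroundness TYPE('a) < \<infinity> \<longleftrightarrow> (\<exists>q\<ge>1. nu_const TYPE('a) q = 2 powr (q - 1))"
    unfolding min_coroundness_def Inf_less_iff by auto
  also have "\<dots> \<longleftrightarrow> (\<exists>q\<ge>1. 2 \<le> q \<and> coroundness_ineq TYPE('a) q)"
    using nu_const_eq_iff[OF nz] by auto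
  also have "\<dots> \<longleftrightarrow> (\<exists>q\<ge>2. coroundness_ineq TYPE('a) q)"
    by (metis one_le_numeral order_trans)
  finally show ?thesis .
qed

lemma coroundness_ineq_imp_uniformly_convex:
  assumes "2 \<le> q" "coroundness_ineq TYPE('a::real_normed_vector) q"
  shows "uniformly_convex TYPE('a) q"
  using assms unfolding uniformly_convex_def coroundness_ineq_def by (auto intro!: exI[of _ 1])

text \<open>Uniform convexity is applied to the half sum and the half difference of two unit vectors.\<close>

lemma uniformly_convex_imp_convexity_power_type:
  assumes nz: "\<exists>x::'a::real_normed_vector. x \<noteq> 0" and uc: "uniformly_convex TYPE('a) q"
  shows "convexity_power_type TYPE('a) q"
proof -
  obtain K where q: "2 \<le> q" and K: "K > 0" "\<And>x y :: 'a.
      2 * (norm x powr q + norm (K *\<^sub>R y) powr q) \<le> norm (x + y) powr q + norm (x - y) powr q"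
    using uc unfolding uniformly_convex_def by auto
  define C where "C = (K / 2) powr q / q"
  have C: "C > 0" using K q by (simp add: C_def)
  have "norm (x + y) / 2 \<le> 1 - C * norm (x - y) powr q" if xy: "norm x = 1" "norm y = 1" for x y :: 'a
  proof -
    define u v where "u = (1/2) *\<^sub>R (x + y)" and "v = (1/2) *\<^sub>R (x - y)"
    have "u + v = x" "u - v = y"
      unfolding u_def v_def
      by (simp_all add: algebra_simps flip: scaleR_left_distrib)
    then have "norm u powr q + norm (K *\<^sub>R v) powr q \<le> 1"
      using K(2)[of u v] xy by simp
    moreover have "norm (K *\<^sub>R v) = K / 2 * norm (x - y)"
      using K(1) by (simp add: v_def)
    then have "norm (K *\<^sub>R v) powr q = q * (C * norm (x - y) powr q)"
      using q by (simp only: powr_mult C_def) simp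
    moreover have "1 + q * (norm u - 1) \<le> norm u powr q"
      using q by (intro powr_ge_tangent_at_1) auto
    ultimately have "q * norm u \<le> q * (1 - C * norm (x - y) powr q)"
      by (simp add: algebra_simps)
    then have "norm u \<le> 1 - C * norm (x - y) powr q"
      using q by (subst (asm) mult_le_cancel_left_pos) auto
    then show ?thesis by (simp add: u_def)
  qed
  then show ?thesis
    unfolding convexity_power_type_iff[OF nz q] using C by blast
qed

lemma support_map_norming:
  fixes f :: "'a::real_normed_vector \<Rightarrow> ('a \<Rightarrow>\<^sub>L real)"
    and z :: 'a
  assumes nz: "\<exists>x::'a. x \<noteq> 0" and supp: "support_map f"
  shows "\<exists>g. norm g = 1 \<and> blinfun_apply g z = norm z"
proof (cases "z = 0")
  case True
  obtain e :: 'a where "norm e = 1"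
    using nz by (metis norm_sgn)
  then show ?thesis
    using support_map_unit(1)[OF supp] True by (intro exI[of _ "f e"]) simp
next
  case False
  have "norm (sgn z) = 1" using False by (simp add: norm_sgn)
  moreover have "z = norm z *\<^sub>R sgn z" using False by (simp add: sgn_div_norm)
  ultimately show ?thesis
    using support_map_unit[OF supp, of "sgn z"]
    by (metis blinfun.scaleR_right mult.right_neutral real_scaleR_def)
qed

text \<open>
  One half of Lindenstrauss' duality formula \<open>\<rho>\<^sub>X(t) = sup (t * \<epsilon> / 2 - \<delta>\<^sub>X\<^sub>*(\<epsilon>))\<close>: with unit functionals
  \<open>g\<close>, \<open>h\<close> norming \<open>x + y\<close> and \<open>x - y\<close>, the sum of the two norms is \<open>(g + h) x + (g - h) y\<close>, and the
  convexity of the dual makes \<open>norm (g + h)\<close> small when \<open>norm (g - h)\<close> is large. Young's inequality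
  evaluates the supremum; the support map provides \<open>g\<close> and \<open>h\<close>.
\<close>

lemma dual_convexity_power_type_imp_smoothness_power_type:
  fixes f :: "'a::real_normed_vector \<Rightarrow> ('a \<Rightarrow>\<^sub>L real)"
  assumes nz: "\<exists>x::'a. x \<noteq> 0" and supp: "support_map f"
    and q: "2 \<le> q" and conv: "convexity_power_type TYPE('a \<Rightarrow>\<^sub>L real) q" and p: "p = q / (q - 1)"
  shows "smoothness_power_type TYPE('a) p"
proof -
  have nz': "\<exists>g::'a \<Rightarrow>\<^sub>L real. g \<noteq> 0"
    using support_map_norming[OF nz supp, of 0] by (metis norm_zero zero_neq_one)
  obtain C where C: "C > 0" "\<And>g h :: 'a \<Rightarrow>\<^sub>L real. norm g = 1 \<Longrightarrow> norm h = 1 \<Longrightarrow>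
      norm (g + h) / 2 \<le> 1 - C * norm (g - h) powr q"
    using conv convexity_power_type_iff[OF nz' q] by auto
  have conj: "1 < p" "1 < q" "1 / p + 1 / q = 1" using q by (auto simp: p field_simps)
  \<comment> \<open>Scaling the two factors by \<open>c\<close> and \<open>1 / c\<close> makes Young's inequality absorb \<open>\<epsilon> powr q\<close> into the convexity.\<close>
  define c where "c = C powr (1 / q)"
  have c: "c > 0" "c powr q = C" using C(1) q by (auto simp: c_def powr_powr)
  define D where "D = (1 / (2 * c)) powr p"
  have D: "D > 0" using c by (simp add: D_def)
  have "norm (x + y) + norm (x - y) \<le> 2 + 2 * (D * norm y powr p)" if x: "norm x = 1" for x y :: 'a
  proof -
    obtain g h where g: "norm g = 1" "blinfun_apply g (x + y) = norm (x + y)"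
      and h: "norm h = 1" "blinfun_apply h (x - y) = norm (x - y)"
      using support_map_norming[OF nz supp] by metis
    define \<epsilon> where "\<epsilon> = norm (g - h)"
    have "norm (x + y) + norm (x - y) = blinfun_apply (g + h) x + blinfun_apply (g - h) y"
      using g h by (simp add: blinfun.bilinear_simps)
    also have "\<dots> \<le> norm (g + h) * norm x + norm (g - h) * norm y"
      by (intro add_mono blinfun_apply_le_norm)
    also have "\<dots> \<le> 2 * (1 - C * \<epsilon> powr q) + \<epsilon> * norm y"
      using C(2)[OF g(1) h(1)] x by (simp add: \<epsilon>_def)
    also have "\<epsilon> * norm y = 2 * ((norm y / (2 * c)) * (c * \<epsilon>))"
      using c by simp
    also have "(norm y / (2 * c)) * (c * \<epsilon>) \<le> (norm y / (2 * c)) powr p / p + (c * \<epsilon>) powr q / q"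
      using conj c by (intro Youngs_inequality) (auto simp: \<epsilon>_def)
    also have "\<dots> \<le> (norm y / (2 * c)) powr p / 1 + (c * \<epsilon>) powr q / 1"
      using conj by (intro add_mono divide_left_mono) auto
    also have "\<dots> = D * norm y powr p + C * \<epsilon> powr q"
      by (simp add: D_def powr_mult powr_divide c)
    finally show ?thesis by simp
  qed
  then show ?thesis
    using smoothness_power_type_iff[OF nz, of p] conj D by auto
qed

section \<open>The equivalences\<close>

theorem corollary5p15:
  fixes f :: "'a::banach \<Rightarrow> ('a \<Rightarrow>\<^sub>L real)"
  assumes nonzero: "\<exists>x::'a. x \<noteq> 0"
    and support: "support_map f"
  shows "(max_roundness TYPE('a) > 1 \<longleftrightarrow> (\<exists>p>1. smoothness_power_type TYPE('a) p))
    \<and> (max_roundness TYPE('a) > 1 \<longleftrightarrow> (\<exists>s>1. uniformly_smooth TYPE('a) s))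
    \<and> (max_roundness TYPE('a) > 1 \<longleftrightarrow> (\<exists>r>1. uniform_norm_expansion f r))
    \<and> (max_roundness TYPE('a) > 1 \<longleftrightarrow> min_coroundness TYPE('a \<Rightarrow>\<^sub>L real) < \<infinity>)
    \<and> (max_roundness TYPE('a) > 1 \<longleftrightarrow> (\<exists>q\<ge>2. convexity_power_type TYPE('a \<Rightarrow>\<^sub>L real) q))
    \<and> (max_roundness TYPE('a) > 1 \<longleftrightarrow> (\<exists>w\<ge>2. uniformly_convex TYPE('a \<Rightarrow>\<^sub>L real) w))"
    (is "(?round \<longleftrightarrow> ?smooth) \<and> (_ \<longleftrightarrow> ?us) \<and> (_ \<longleftrightarrow> ?expand) \<and> (_ \<longleftrightarrow> ?coround) \<and> (_ \<longleftrightarrow> ?convex) \<and> (_ \<longleftrightarrow> ?uc)")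
proof -
  have nonzero_dual: "\<exists>g::'a \<Rightarrow>\<^sub>L real. g \<noteq> 0"
    using nonzero support unfolding support_map_def by blast
  note round_iff = max_roundness_gt_1_iff[where 'a = 'a]
  note coround_iff = min_coroundness_less_infinity_iff[OF nonzero_dual]
  have 1: ?us if ?round
    using that unfolding round_iff
    by (meson roundness_ineq_imp_uniformly_smooth[OF nonzero] less_imp_le)
  have 2: ?smooth if ?us
    using that uniformly_smooth_imp_smoothness_power_type[OF nonzero] by blast
  have 3: ?round if ?smooth
    using that smoothness_power_type_imp_roundness_ineq[OF nonzero] unfolding round_iff by blast
  have 4: ?expand if ?smooth
    using that smoothness_power_type_imp_uniform_norm_expansion[OF nonzero support]
    by (meson less_imp_le)
  have 5: ?smooth if ?expand
    using that uniform_norm_expansion_imp_smoothness_power_type[OF nonzero] by (meson less_imp_le)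
  have 6: ?coround if ?round
  proof -
    obtain p where p: "1 < p" "roundness_ineq TYPE('a) p" using \<open>?round\<close> round_iff by blast
    then have "p \<le> 2" using roundness_ineq_imp_le_2[OF nonzero] by blast
    then have "2 \<le> p / (p - 1)" using p by (simp add: field_simps)
    then show ?thesis
      using roundness_ineq_imp_coroundness_ineq_dual[OF p refl] unfolding coround_iff by blast
  qed
  have 7: ?uc if ?coround
    using that coroundness_ineq_imp_uniformly_convex unfolding coround_iff by blast
  have 8: ?convex if ?uc
    using that uniformly_convex_imp_convexity_power_type[OF nonzero_dual] by blast
  have 9: ?smooth if ?convex
  proof -
    obtain q where q: "2 \<le> q" "convexity_power_type TYPE('a \<Rightarrow>\<^sub>L real) q" using \<open>?convex\<close> by blast
    have "1 < q / (q - 1)" using q by (simp add: field_simps)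
    then show ?thesis
      using dual_convexity_power_type_imp_smoothness_power_type[OF nonzero support q refl] by blast
  qed
  show ?thesis using 1 2 3 4 5 6 7 8 9 by blast
qed

end
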